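(* Let $(S,+,\cdot)$ be a semiring and let $(R,\cdot)$ be a subsemigroup of $(S,\cdot)$ such that $R$ is central in $(S,+)$ and, for every $r \in R$, the set $rS = \{rs : s \in S\}$ is piecewise syndetic in $(S,+)$. If $A \subseteq R$ is syndetic in $(R,\cdot)$, then $A$ is central in $(S,+)$.
   Context: A semiring $(S,+,\cdot)$ is a set with two binary operations such that $(S,+)$ is a commutative semigroup, $(S,\cdot)$ is a semigroup (not necessarily commutative), and both distributive laws $s(s_1+s_2)=ss_1+ss_2$, $(s_1+s_2)s = s_1s+s_2s$ hold. For a semigroup $(T,\cdot)$, $x \in T$ and $B \subseteq T$, write $x^{-1}B = \{t \in T : xt \in B\}$ (in an additively written semigroup, $B - x = \{t : t+x \in B\}$). A set $B \subseteq T$ is syndetic in $(T,\cdot)$ if there are $t_1,\dots,t_k \in T$ with $T = t_1^{-1}B \cup \dots \cup t_k^{-1}B$ (here, for $B \subseteq R$ syndetic in $(R,\cdot)$, the sets $r_i^{-1}B$ are computed inside $R$). A set $B$ is thick in $(T,\cdot)$ if for every finite $F \subseteq T$ there is $x \in T$ with $Fx \subseteq B$; $B$ is piecewise syndetic if there are $t_1,\dots,t_k \in T$ with $t_1^{-1}B \cup \dots \cup t_k^{-1}B$ thick. A set $B \subseteq S$ is central in $(S,+)$ if it is a member of a minimal idempotent ultrafilter in the Stone–Čech compactification semigroup $(\beta S,+)$ (an idempotent lying in the smallest two-sided ideal of $(\beta S,+)$). *)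

theory Defs
  imports Main
begin

section \<open>Syndetic, thick and piecewise syndetic sets\<close>

text \<open>
  The carrier \<open>T\<close> and the operation \<open>f\<close> are explicit, because these notions are needed for
  a multiplicative subsemigroup of a semiring and for the additive semigroup of the whole semiring.
\<close>

definition subsemigroup :: "('a \<Rightarrow> 'a \<Rightarrow> 'a) \<Rightarrow> 'a set \<Rightarrow> bool" where
  "subsemigroup f R \<longleftrightarrow> R \<noteq> {} \<and> (\<forall>x\<in>R. \<forall>y\<in>R. f x y \<in> R)"

text \<open>
  \<open>translate T f t B\<close> is \<open>t\<^sup>-\<^sup>1B\<close>, computed inside \<open>T\<close>. For a commutative operation written
  additively this is \<open>B - t\<close>.
\<close>

definition translate :: "'a set \<Rightarrow> ('a \<Rightarrow> 'a \<Rightarrow> 'a) \<Rightarrow> 'a \<Rightarrow> 'a set \<Rightarrow> 'a set" where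
  "translate T f t B = {x \<in> T. f t x \<in> B}"

definition syndetic :: "'a set \<Rightarrow> ('a \<Rightarrow> 'a \<Rightarrow> 'a) \<Rightarrow> 'a set \<Rightarrow> bool" where
  "syndetic T f B \<longleftrightarrow> (\<exists>F. finite F \<and> F \<subseteq> T \<and> T = (\<Union>t\<in>F. translate T f t B))"

definition thick :: "'a set \<Rightarrow> ('a \<Rightarrow> 'a \<Rightarrow> 'a) \<Rightarrow> 'a set \<Rightarrow> bool" where
  "thick T f B \<longleftrightarrow> (\<forall>F. finite F \<and> F \<subseteq> T \<longrightarrow> (\<exists>x\<in>T. (\<lambda>t. f t x) ` F \<subseteq> B))"

definition piecewise_syndetic :: "'a set \<Rightarrow> ('a \<Rightarrow> 'a \<Rightarrow> 'a) \<Rightarrow> 'a set \<Rightarrow> bool" where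
  "piecewise_syndetic T f B \<longleftrightarrow>
     (\<exists>F. finite F \<and> F \<subseteq> T \<and> thick T f (\<Union>t\<in>F. translate T f t B))"


section \<open>The semigroup of ultrafilters and central sets\<close>

text \<open>
  The Stone-Cech compactification of a discrete semigroup is realised as the set of ultrafilters
  on it. A set \<open>A\<close> is a member of \<open>p\<close> iff \<open>eventually (\<lambda>x. x \<in> A) p\<close>.
\<close>

definition ultrafilter :: "'a filter \<Rightarrow> bool" where
  "ultrafilter p \<longleftrightarrow> p \<noteq> bot \<and> (\<forall>P. eventually P p \<or> eventually (\<lambda>x. \<not> P x) p)"

definition stone_cech :: "'a filter set" where
  "stone_cech = {p. ultrafilter p}"

text \<open>
  \<open>A \<in> p + q\<close> iff \<open>{x. {y. x + y \<in> A} \<in> q} \<in> p\<close>. The other convention in use gives, over a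
  commutative semigroup, the opposite operation, which has the same idempotents and the same
  two-sided ideals.
\<close>

definition beta_add :: "'a::ab_semigroup_add filter \<Rightarrow> 'a filter \<Rightarrow> 'a filter" where
  "beta_add p q = Abs_filter (\<lambda>P. eventually (\<lambda>x. eventually (\<lambda>y. P (x + y)) q) p)"

lemma eventually_beta_add:
  "eventually P (beta_add p q) \<longleftrightarrow> eventually (\<lambda>x. eventually (\<lambda>y. P (x + y)) q) p"
  unfolding beta_add_def
proof (rule eventually_Abs_filter, rule is_filter.intro, goal_cases)
  case 1
  then show ?case by simp
next
  case (2 P Q)
  then show ?case by eventually_elim (rule eventually_conj)
next
  case (3 P Q)
  show ?case
    by (rule eventually_mono[OF 3(2)], erule eventually_mono) (use 3(1) in blast)
qed

lemma beta_add_in_stone_cech: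
  assumes "p \<in> stone_cech" "q \<in> stone_cech"
  shows "beta_add p q \<in> stone_cech"
proof -
  have q: "eventually (\<lambda>y. \<not> Q y) q \<longleftrightarrow> \<not> eventually Q q" for Q
    using assms(2) eventually_conj[of Q q "\<lambda>y. \<not> Q y"]
    by (auto simp: stone_cech_def ultrafilter_def trivial_limit_def)
  show ?thesis
    using assms by (auto simp: stone_cech_def ultrafilter_def trivial_limit_def
        eventually_beta_add q)
qed

lemma beta_add_assoc: "beta_add (beta_add p q) r = beta_add p (beta_add q r)"
  by (simp add: filter_eq_iff eventually_beta_add add.assoc)

definition beta_ideal :: "'a::ab_semigroup_add filter set \<Rightarrow> bool" where
  "beta_ideal I \<longleftrightarrow> I \<noteq> {} \<and> I \<subseteq> stone_cech \<and>
     (\<forall>p\<in>I. \<forall>q\<in>stone_cech. beta_add p q \<in> I \<and> beta_add q p \<in> I)"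

text \<open>
  The intersection of all two-sided ideals is the smallest one as soon as a smallest one exists,
  which is always the case for a compact right topological semigroup.
\<close>

definition smallest_ideal :: "'a::ab_semigroup_add filter set" where
  "smallest_ideal = \<Inter> {I. beta_ideal I}"

definition minimal_idempotent :: "'a::ab_semigroup_add filter \<Rightarrow> bool" where
  "minimal_idempotent p \<longleftrightarrow> p \<in> smallest_ideal \<and> beta_add p p = p"

definition central :: "'a::ab_semigroup_add set \<Rightarrow> bool" where
  "central B \<longleftrightarrow> (\<exists>p. minimal_idempotent p \<and> eventually (\<lambda>x. x \<in> B) p)"

end

theory Submission
  imports Defs
begin

text \<open>
  Let \<open>p\<close> be a minimal idempotent containing \<open>R\<close>. Since finitely many \<open>r\<^sup>-\<^sup>1A\<close> cover \<open>R\<close>, one of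
  them belongs to \<open>p\<close>, so \<open>A\<close> belongs to the image \<open>rp\<close> of \<open>p\<close> under \<open>x \<mapsto> rx\<close>. This map is an
  additive homomorphism, hence \<open>rp\<close> is idempotent. For minimality, let \<open>I\<close> be an ideal. Its
  preimage \<open>{q. rq \<in> I}\<close> is closed under addition of arbitrary ultrafilters on either side; it is
  nonempty because \<open>rS\<close> is piecewise syndetic and a piecewise syndetic set belongs to a member of
  every ideal. So the preimage is an ideal and contains \<open>p\<close>, which means \<open>rp \<in> I\<close>.
\<close>

lemma stone_cech_not_eventually_iff:
  assumes "p \<in> stone_cech"
  shows "eventually (\<lambda>x. \<not> P x) p \<longleftrightarrow> \<not> eventually P p"
  using assms eventually_conj[of P p "\<lambda>x. \<not> P x"]
  by (auto simp: stone_cech_def ultrafilter_def trivial_limit_def)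

text \<open>If no \<open>B t\<close> were a member of \<open>p\<close>, all their complements would
  be, and so would the finite intersection of these, which misses the union.\<close>

lemma stone_cech_eventually_UN:
  assumes "p \<in> stone_cech" "finite F" "eventually (\<lambda>x. x \<in> (\<Union>t\<in>F. B t)) p"
  obtains t where "t \<in> F" "eventually (\<lambda>x. x \<in> B t) p"
proof -
  have "\<exists>t\<in>F. eventually (\<lambda>x. x \<in> B t) p"
  proof (rule ccontr)
    assume "\<not> ?thesis"
    then have "\<forall>t\<in>F. eventually (\<lambda>x. x \<notin> B t) p"
      using stone_cech_not_eventually_iff[OF assms(1)] by blast
    then have "eventually (\<lambda>x. \<forall>t\<in>F. x \<notin> B t) p"
      using assms(2) by (simp add: eventually_ball_finite)
    then have "eventually (\<lambda>x. \<not> x \<in> (\<Union>t\<in>F. B t)) p"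
      by (rule eventually_mono) simp
    then show False
      using assms(3) stone_cech_not_eventually_iff[OF assms(1)] by blast
  qed
  then show thesis
    using that by blast
qed

lemma ultrafilter_finer_eq:
  assumes "u \<in> stone_cech" "G \<le> u" "G \<noteq> bot"
  shows "G = u"
proof (rule antisym)
  show "u \<le> G"
  proof (rule filter_leI)
    fix P assume P: "eventually P G"
    show "eventually P u"
    proof (rule ccontr)
      assume "\<not> eventually P u"
      then have "eventually (\<lambda>x. \<not> P x) G"
        using assms(2) stone_cech_not_eventually_iff[OF assms(1)] filter_leD by blast
      with P have "eventually (\<lambda>x. False) G"
        by eventually_elim simp
      then show False
        using assms(3) by (simp add: trivial_limit_def)
    qed
  qed
qed (rule assms(2))

text \<open>Zorn's lemma on the proper filters below \<open>G\<close>. Smaller filters have more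
  members, so a minimal proper filter is an ultrafilter.\<close>

lemma ultrafilter_exists_le:
  assumes "G \<noteq> bot"
  obtains u where "u \<in> stone_cech" "u \<le> G"
proof -
  define X where "X = {H. H \<noteq> bot \<and> H \<le> G}"
  have "\<exists>m\<in>X. \<forall>a\<in>X. m \<ge> a \<longrightarrow> a = m"
  proof (rule predicate_Zorn[of X "\<lambda>a b. a \<ge> b"])
    show "partial_order_on X (relation_of (\<lambda>a b. a \<ge> b) X)"
      by (rule partial_order_on_relation_ofI) auto
    fix C assume C: "C \<in> Chains (relation_of (\<lambda>a b. a \<ge> b) X)"
    then have CX: "C \<subseteq> X"
      by (rule Chains_relation_of)
    show "\<exists>u\<in>X. \<forall>a\<in>C. a \<ge> u"
    \<comment> \<open>The infimum of the empty chain is the top filter, which need not lie below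
      \<open>G\<close>; there \<open>G\<close> itself is the bound.\<close>
    proof (cases "C = {}")
      case True
      then show ?thesis
        using assms by (auto simp: X_def)
    next
      case False
      have chain: "a \<le> b \<or> b \<le> a" if "a \<in> C" "b \<in> C" for a b
        using C that by (auto simp: Chains_def relation_of_def)
      \<comment> \<open>A nonempty chain is directed, so whatever holds eventually in its infimum
        already does so in one of its filters; each of these is proper.\<close>
      have "Inf C \<noteq> bot"
      proof
        assume "Inf C = bot"
        then have "eventually (\<lambda>x. False) (Inf C)"
          by simp
        then obtain a where "a \<in> C" "eventually (\<lambda>x. False) a"
          using eventually_Inf_base[OF False] chain by (metis inf.orderE inf_commute order_refl)
        then show False
          using CX by (auto simp: X_def trivial_limit_def)
      qed
      moreover have "Inf C \<le> G"
        using False CX by (auto simp: X_def intro: Inf_lower2)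
      ultimately show ?thesis
        by (auto simp: X_def intro: Inf_lower)
    qed
  qed
  then obtain u where u: "u \<noteq> bot" "u \<le> G" "\<And>a. a \<noteq> bot \<Longrightarrow> a \<le> u \<Longrightarrow> a = u"
    unfolding X_def by (blast intro: order_trans)
  have "eventually P u" if "\<not> eventually (\<lambda>x. \<not> P x) u" for P
  proof -
    \<comment> \<open>Adjoining \<open>{x. P x}\<close> to \<open>u\<close> keeps it proper, since
      the complement is not a member; minimality then forces the set to be in \<open>u\<close>
      already.\<close>
    have "inf u (principal {x. P x}) \<noteq> bot"
      using that by (simp add: trivial_limit_def eventually_inf_principal)
    then have "inf u (principal {x. P x}) = u"
      using u(3) by simp
    moreover have "eventually P (inf u (principal {x. P x}))"
      by (simp add: eventually_inf_principal)
    ultimately show ?thesis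
      by simp
  qed
  then have "u \<in> stone_cech"
    using u(1) by (auto simp: stone_cech_def ultrafilter_def)
  then show thesis
    using u(2) that by blast
qed

lemma principal_in_stone_cech: "principal {t} \<in> stone_cech"
  by (auto simp: stone_cech_def ultrafilter_def trivial_limit_def eventually_principal)

lemma filtermap_in_stone_cech:
  assumes "p \<in> stone_cech"
  shows "filtermap f p \<in> stone_cech"
  using assms by (auto simp: stone_cech_def ultrafilter_def filtermap_bot_iff eventually_filtermap)

text \<open>As \<open>range f\<close> is in \<open>u\<close>, the preimages of members of
  \<open>u\<close> generate a proper filter. Any ultrafilter refining it is mapped below
  \<open>u\<close>, hence onto \<open>u\<close>.\<close>

lemma filtermap_surj_stone_cech:
  assumes "u \<in> stone_cech" "eventually (\<lambda>x. x \<in> range f) u"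
  obtains q where "q \<in> stone_cech" "filtermap f q = u"
proof -
  have "filtercomap f u \<noteq> bot"
  proof
    assume "filtercomap f u = bot"
    then have "eventually (\<lambda>x. False) (filtercomap f u)"
      by simp
    then obtain Q where Q: "eventually Q u" "\<And>x. \<not> Q (f x)"
      by (auto simp: eventually_filtercomap)
    from Q(1) assms(2) have "eventually (\<lambda>x. False) u"
      by eventually_elim (use Q(2) in auto)
    then show False
      using assms(1) by (simp add: stone_cech_def ultrafilter_def trivial_limit_def)
  qed
  then obtain q where q: "q \<in> stone_cech" "q \<le> filtercomap f u"
    by (rule ultrafilter_exists_le)
  have "filtermap f q = u"
  proof (rule ultrafilter_finer_eq[OF assms(1)])
    show "filtermap f q \<le> u"
      using q(2) by (simp add: filtermap_le_iff_le_filtercomap)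
    show "filtermap f q \<noteq> bot"
      using q(1) by (simp add: filtermap_bot_iff stone_cech_def ultrafilter_def)
  qed
  then show thesis
    using q(1) that by blast
qed

lemma filtermap_beta_add:
  assumes "\<And>x y. f (x + y) = f x + f y"
  shows "filtermap f (beta_add p q) = beta_add (filtermap f p) (filtermap f q)"
  by (simp add: filter_eq_iff eventually_filtermap eventually_beta_add assms)

text \<open>Thickness is the finite intersection property of the sets
  \<open>{x. s + x \<in> T}\<close>.\<close>

lemma thick_ultrafilter:
  fixes T :: "'a::ab_semigroup_add set"
  assumes "thick UNIV (+) T"
  obtains q where "q \<in> stone_cech" "\<And>s. eventually (\<lambda>x. s + x \<in> T) q"
proof -
  have "(INF s. principal {x. s + x \<in> T}) \<noteq> bot"
  proof (rule INF_filter_not_bot)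
    fix F :: "'a set" assume "finite F"
    then have "(INF s\<in>F. principal {x. s + x \<in> T}) = principal (\<Inter>s\<in>F. {x. s + x \<in> T})"
      by (rule INF_principal_finite)
    moreover from assms \<open>finite F\<close> obtain x where "(\<lambda>s. s + x) ` F \<subseteq> T"
      by (auto simp: thick_def)
    then have "x \<in> (\<Inter>s\<in>F. {x. s + x \<in> T})"
      by auto
    ultimately show "(INF s\<in>F. principal {x. s + x \<in> T}) \<noteq> bot"
      by (metis empty_iff principal_eq_bot_iff)
  qed
  then obtain q where q: "q \<in> stone_cech" "q \<le> (INF s. principal {x. s + x \<in> T})"
    by (rule ultrafilter_exists_le)
  have "eventually (\<lambda>x. s + x \<in> T) q" for s
  proof -
    have "q \<le> principal {x. s + x \<in> T}"
      using q(2) by (simp add: le_INF_iff)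
    then show ?thesis
      by (simp add: le_principal)
  qed
  then show thesis
    using q(1) that by blast
qed

lemma piecewise_syndetic_meets_beta_ideal:
  fixes B :: "'a::ab_semigroup_add set"
  assumes "piecewise_syndetic UNIV (+) B" "beta_ideal I"
  obtains u where "u \<in> I" "eventually (\<lambda>x. x \<in> B) u"
proof -
  obtain F where F: "finite F" "thick UNIV (+) (\<Union>t\<in>F. translate UNIV (+) t B)" (is "thick _ _ ?T")
    using assms(1) by (auto simp: piecewise_syndetic_def)
  obtain q where q: "q \<in> stone_cech" "\<And>s. eventually (\<lambda>x. s + x \<in> ?T) q"
    by (rule thick_ultrafilter[OF F(2)]) blast
  obtain v where v: "v \<in> I"
    using assms(2) by (auto simp: beta_ideal_def)
  have vq: "beta_add v q \<in> I" "beta_add v q \<in> stone_cech"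
    using assms(2) v q(1) by (auto simp: beta_ideal_def)
  \<comment> \<open>The inner condition holds for every first summand, so \<open>v\<close> may be
    arbitrary; it only serves to land in \<open>I\<close>.\<close>
  have "eventually (\<lambda>x. x \<in> ?T) (beta_add v q)"
    unfolding eventually_beta_add by (rule always_eventually) (use q(2) in blast)
  then obtain t where t: "eventually (\<lambda>x. x \<in> translate UNIV (+) t B) (beta_add v q)"
    by (rule stone_cech_eventually_UN[OF vq(2) F(1)])
  \<comment> \<open>Adding \<open>t\<close> on the left turns membership of the translate by
    \<open>t\<close> into membership of \<open>B\<close>, without leaving the ideal.\<close>
  have "beta_add (principal {t}) (beta_add v q) \<in> I"
    using assms(2) vq(1) principal_in_stone_cech[of t] by (simp add: beta_ideal_def)
  moreover have "eventually (\<lambda>x. x \<in> B) (beta_add (principal {t}) (beta_add v q))"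
    using t unfolding eventually_beta_add[of _ "principal {t}"]
    by (simp add: translate_def eventually_principal)
  ultimately show thesis
    by (rule that)
qed

lemma filtermap_smallest_ideal:
  fixes f :: "'a::ab_semigroup_add \<Rightarrow> 'a"
  assumes add: "\<And>x y. f (x + y) = f x + f y"
    and ps: "piecewise_syndetic UNIV (+) (range f)"
    and p: "p \<in> smallest_ideal"
  shows "filtermap f p \<in> smallest_ideal"
  unfolding smallest_ideal_def
proof (rule InterI)
  fix I :: "'a filter set" assume "I \<in> {I. beta_ideal I}"
  then have I: "beta_ideal I"
    by simp
  obtain u where u: "u \<in> I" "eventually (\<lambda>x. x \<in> range f) u"
    by (rule piecewise_syndetic_meets_beta_ideal[OF ps I])
  have "u \<in> stone_cech"
    using I u(1) by (auto simp: beta_ideal_def)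
  then obtain q where q: "q \<in> stone_cech" "filtermap f q = u"
    by (rule filtermap_surj_stone_cech[OF _ u(2)])
  \<comment> \<open>The ultrafilter \<open>q\<close> shows that the preimage is nonempty; absorption
    holds because \<open>filtermap f\<close> is a homomorphism from \<open>stone_cech\<close> to
    itself.\<close>
  have "beta_ideal {q \<in> stone_cech. filtermap f q \<in> I}"
    using I q u(1)
    by (auto simp: beta_ideal_def beta_add_in_stone_cech filtermap_in_stone_cech
        filtermap_beta_add[where f = f, OF add])
  then show "filtermap f p \<in> I"
    using p by (auto simp: smallest_ideal_def)
qed

text \<open>This guarantees that the members of \<open>smallest_ideal\<close> are
  ultrafilters.\<close>

lemma beta_ideal_stone_cech: "beta_ideal stone_cech"
  unfolding beta_ideal_def
  by (metis beta_add_in_stone_cech empty_iff principal_in_stone_cech subset_refl)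

theorem theorem6p1:
  fixes R A :: "'a::semiring set"
  assumes "subsemigroup (*) R"
    and "central R"
    and "\<And>r. r \<in> R \<Longrightarrow> piecewise_syndetic UNIV (+) {r * s | s. s \<in> UNIV}"
    and "A \<subseteq> R"
    and "syndetic R (*) A"
  shows "central A"
proof -
  obtain p where p: "p \<in> smallest_ideal" "beta_add p p = p" "eventually (\<lambda>x. x \<in> R) p"
    using assms(2) by (auto simp: central_def minimal_idempotent_def)
  have p_sc: "p \<in> stone_cech"
    using p(1) beta_ideal_stone_cech by (auto simp: smallest_ideal_def)
  obtain F where F: "finite F" "F \<subseteq> R" "R = (\<Union>t\<in>F. translate R (*) t A)"
    using assms(5) by (auto simp: syndetic_def)
  have "eventually (\<lambda>x. x \<in> (\<Union>t\<in>F. translate R (*) t A)) p"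
    using p(3) by (rule eventually_mono) (use F(3) in blast)
  then obtain r where r: "r \<in> F" "eventually (\<lambda>x. x \<in> translate R (*) r A) p"
    by (rule stone_cech_eventually_UN[OF p_sc F(1)])
  let ?q = "filtermap ((*) r) p"
  have "piecewise_syndetic UNIV (+) (range ((*) r))"
    using assms(3)[of r] r(1) F(2) by (auto simp: full_SetCompr_eq)
  then have "?q \<in> smallest_ideal"
    using p(1) by (intro filtermap_smallest_ideal) (simp_all add: distrib_left)
  moreover have "beta_add ?q ?q = ?q"
    using filtermap_beta_add[of "(*) r" p p] p(2) by (simp add: distrib_left)
  moreover have "eventually (\<lambda>x. x \<in> A) ?q"
    using r(2) by (auto simp: eventually_filtermap translate_def elim: eventually_mono)
  ultimately show ?thesis
    by (auto simp: central_def minimal_idempotent_def)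
qed

end
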